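(* Let $\mathcal{T}=(T_t)_{t\in\mathbb{R}}$ be an ergodic and aperiodic measure-preserving flow on a standard Borel probability space $(X,\mathcal{B},\mu)$, and let $d\geq1$. Suppose that there exist a sequence $(\bar q_n)_{n\ge1}$ in $\mathbb{R}^d$ and a Borel probability measure $Q$ on $\mathbb{R}^{\{0,1\}^{\prime d}}$ such that $$\mu_{(\bar q_n(\bar\varepsilon))_{\bar\varepsilon\in\{0,1\}^{\prime d}}}\to\int_{\mathbb{R}^{\{0,1\}^{\prime d}}}\mu_{-\bar t}\,dQ(\bar t)\quad\text{in } J_{2^d}(\mathcal{T}).$$ If $Q$ is not invariant under the map $\bar\theta:\mathbb{R}^{\{0,1\}^{\prime d}}\to\mathbb{R}^{\{0,1\}^{\prime d}}$ given by $$\bar\theta\big((\bar t_{\bar\varepsilon})_{\bar\varepsilon\in\{0,1\}^{\prime d}}\big)=\big(\bar t_{(1,\ldots,1)}-\bar t_{I(\bar\varepsilon)}\big)_{\bar\varepsilon\in\{0,1\}^{\prime d}},\qquad I(\varepsilon_0,\ldots,\varepsilon_{d-1})=(1-\varepsilon_0,\ldots,1-\varepsilon_{d-1}),$$ then $\mathcal{T}$ is not isomorphic to its inverse. In particular, $\mathcal{T}$ is not reversible.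
   Context: $\{0,1\}^{\prime d}=\{0,1\}^d\setminus\{(0,\ldots,0)\}$. For $\bar x=(x_0,\dots,x_{d-1})\in\mathbb{R}^d$ and $\bar\varepsilon=(\varepsilon_0,\dots,\varepsilon_{d-1})$, $\bar x(\bar\varepsilon)=\varepsilon_0x_0+\dots+\varepsilon_{d-1}x_{d-1}$. Convention: $\bar t_{(0,\ldots,0)}=0$ for every $\bar t\in\mathbb{R}^{\{0,1\}^{\prime d}}$. For $\bar t\in\mathbb{R}^{\{0,1\}^{\prime d}}$, $\mu_{\bar t}$ is the measure on $X^{\{0,1\}^d}$ with $\mu_{\bar t}\big(\prod_{\bar\varepsilon\in\{0,1\}^d}A_{\bar\varepsilon}\big)=\mu\big(\bigcap_{\bar\varepsilon\in\{0,1\}^d}T_{-\bar t_{\bar\varepsilon}}A_{\bar\varepsilon}\big)$. $J_{2^d}(\mathcal{T})$ is the set of $(T_t\times\dots\times T_t)_{t}$-invariant probability measures on $X^{\{0,1\}^d}$ all of whose one-dimensional marginals equal $\mu$, with convergence meaning convergence of the values on all measurable product sets $\prod A_{\bar\varepsilon}$. Integrals of joinings are defined setwise. Aperiodic: for every $t\ne0$, $\mu(\{x:T_tx=x\})=0$. $\mathcal{T}$ is isomorphic to its inverse if there is an invertible measure-preserving $S:X\to X$ with $T_t\circ S=S\circ T_{-t}$ for all $t\in\mathbb{R}$; it is reversible if such an $S$ can be chosen with $S^2=\mathrm{Id}$. *)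

theory Defs
  imports "HOL-Probability.Probability"
begin

text \<open>A measurable space is standard Borel if its \<sigma>-algebra is the Borel \<sigma>-algebra of
  some Polish topology on its underlying set.\<close>

definition standard_borel :: "'x measure \<Rightarrow> bool" where
  "standard_borel M \<longleftrightarrow>
     (\<exists>X. completely_metrizable_space X \<and> separable_space X \<and>
          topspace X = space M \<and> sets M = sigma_sets (topspace X) {U. openin X U})"


subsection \<open>Measure-preserving flows\<close>

locale mp_flow = prob_space M for M :: "'x measure" +
  fixes T :: "real \<Rightarrow> 'x \<Rightarrow> 'x"
  assumes measurable_flow: "(\<lambda>(t, x). T t x) \<in> borel \<Otimes>\<^sub>M M \<rightarrow>\<^sub>M M"
    and flow_0: "x \<in> space M \<Longrightarrow> T 0 x = x"
    and flow_add: "x \<in> space M \<Longrightarrow> T (s + t) x = T s (T t x)"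
    and flow_preserving: "distr M M (T t) = M"

definition ergodic_flow :: "'x measure \<Rightarrow> (real \<Rightarrow> 'x \<Rightarrow> 'x) \<Rightarrow> bool" where
  "ergodic_flow M T \<longleftrightarrow>
     (\<forall>A\<in>sets M. (\<forall>t. T t -` A \<inter> space M = A) \<longrightarrow> emeasure M A = 0 \<or> emeasure M A = 1)"

definition aperiodic_flow :: "'x measure \<Rightarrow> (real \<Rightarrow> 'x \<Rightarrow> 'x) \<Rightarrow> bool" where
  "aperiodic_flow M T \<longleftrightarrow> (\<forall>t. t \<noteq> 0 \<longrightarrow> {x \<in> space M. T t x = x} \<in> null_sets M)"

text \<open>As usual in ergodic theory, invertibility of a measure-preserving map and identities between
  such maps are understood modulo null sets.\<close>

definition invertible_mp :: "'x measure \<Rightarrow> ('x \<Rightarrow> 'x) \<Rightarrow> bool" where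
  "invertible_mp M S \<longleftrightarrow>
     S \<in> M \<rightarrow>\<^sub>M M \<and> distr M M S = M \<and>
     (\<exists>R. R \<in> M \<rightarrow>\<^sub>M M \<and> distr M M R = M \<and>
          (AE x in M. R (S x) = x) \<and> (AE x in M. S (R x) = x))"

definition inverting_map :: "'x measure \<Rightarrow> (real \<Rightarrow> 'x \<Rightarrow> 'x) \<Rightarrow> ('x \<Rightarrow> 'x) \<Rightarrow> bool" where
  "inverting_map M T S \<longleftrightarrow>
     invertible_mp M S \<and> (\<forall>t. AE x in M. T t (S x) = S (T (- t) x))"

definition isomorphic_to_inverse :: "'x measure \<Rightarrow> (real \<Rightarrow> 'x \<Rightarrow> 'x) \<Rightarrow> bool" where
  "isomorphic_to_inverse M T \<longleftrightarrow> (\<exists>S. inverting_map M T S)"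

definition reversible :: "'x measure \<Rightarrow> (real \<Rightarrow> 'x \<Rightarrow> 'x) \<Rightarrow> bool" where
  "reversible M T \<longleftrightarrow> (\<exists>S. inverting_map M T S \<and> (AE x in M. S (S x) = x))"


subsection \<open>The discrete cube\<close>

definition cube :: "nat \<Rightarrow> (nat \<Rightarrow> nat) set" where
  "cube d = {..<d} \<rightarrow>\<^sub>E {0, 1}"

definition zero_vertex :: "nat \<Rightarrow> nat \<Rightarrow> nat" where
  "zero_vertex d = (\<lambda>i\<in>{..<d}. 0)"

definition one_vertex :: "nat \<Rightarrow> nat \<Rightarrow> nat" where
  "one_vertex d = (\<lambda>i\<in>{..<d}. 1)"

definition pcube :: "nat \<Rightarrow> (nat \<Rightarrow> nat) set" where
  "pcube d = cube d - {zero_vertex d}"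

definition opposite :: "nat \<Rightarrow> (nat \<Rightarrow> nat) \<Rightarrow> nat \<Rightarrow> nat" where
  "opposite d \<epsilon> = (\<lambda>i\<in>{..<d}. 1 - \<epsilon> i)"

text \<open>Only the first \<open>d\<close> entries of \<open>x\<close>, regarded as a vector in \<open>d\<close>-dimensional space, matter.\<close>

definition vertex_sum :: "nat \<Rightarrow> (nat \<Rightarrow> real) \<Rightarrow> (nat \<Rightarrow> nat) \<Rightarrow> real" where
  "vertex_sum d x \<epsilon> = (\<Sum>i<d. real (\<epsilon> i) * x i)"

text \<open>The space of real vectors indexed by the punctured cube, with its Borel \<sigma>-algebra.\<close>

abbreviation param_space :: "nat \<Rightarrow> ((nat \<Rightarrow> nat) \<Rightarrow> real) measure" where
  "param_space d \<equiv> Pi\<^sub>M (pcube d) (\<lambda>_. borel)"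

text \<open>The convention that the coordinate at the zero vertex is 0.\<close>

definition coord :: "nat \<Rightarrow> ((nat \<Rightarrow> nat) \<Rightarrow> real) \<Rightarrow> (nat \<Rightarrow> nat) \<Rightarrow> real" where
  "coord d t \<epsilon> = (if \<epsilon> = zero_vertex d then 0 else t \<epsilon>)"

definition theta :: "nat \<Rightarrow> ((nat \<Rightarrow> nat) \<Rightarrow> real) \<Rightarrow> (nat \<Rightarrow> nat) \<Rightarrow> real" where
  "theta d t = (\<lambda>\<epsilon>\<in>pcube d. coord d t (one_vertex d) - coord d t (opposite d \<epsilon>))"


subsection \<open>Self-joinings indexed by the cube\<close>

abbreviation cube_space :: "nat \<Rightarrow> 'x measure \<Rightarrow> ((nat \<Rightarrow> nat) \<Rightarrow> 'x) measure" where
  "cube_space d M \<equiv> Pi\<^sub>M (cube d) (\<lambda>_. M)"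

definition diagonal_flow ::
    "nat \<Rightarrow> (real \<Rightarrow> 'x \<Rightarrow> 'x) \<Rightarrow> real \<Rightarrow> ((nat \<Rightarrow> nat) \<Rightarrow> 'x) \<Rightarrow> (nat \<Rightarrow> nat) \<Rightarrow> 'x" where
  "diagonal_flow d T t x = (\<lambda>\<epsilon>\<in>cube d. T t (x \<epsilon>))"

definition joinings ::
    "nat \<Rightarrow> 'x measure \<Rightarrow> (real \<Rightarrow> 'x \<Rightarrow> 'x) \<Rightarrow> ((nat \<Rightarrow> nat) \<Rightarrow> 'x) measure set" where
  "joinings d M T = {\<nu>. prob_space \<nu> \<and> sets \<nu> = sets (cube_space d M) \<and>
     (\<forall>t. distr \<nu> (cube_space d M) (diagonal_flow d T t) = \<nu>) \<and>
     (\<forall>\<epsilon>\<in>cube d. distr \<nu> M (\<lambda>x. x \<epsilon>) = M)}"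

definition joinings_tendsto ::
    "nat \<Rightarrow> 'x measure \<Rightarrow> (real \<Rightarrow> 'x \<Rightarrow> 'x) \<Rightarrow>
      (nat \<Rightarrow> ((nat \<Rightarrow> nat) \<Rightarrow> 'x) measure) \<Rightarrow> ((nat \<Rightarrow> nat) \<Rightarrow> 'x) measure \<Rightarrow> bool" where
  "joinings_tendsto d M T \<nu> \<rho> \<longleftrightarrow>
     (\<forall>n. \<nu> n \<in> joinings d M T) \<and> \<rho> \<in> joinings d M T \<and>
     (\<forall>A. (\<forall>\<epsilon>\<in>cube d. A \<epsilon> \<in> sets M) \<longrightarrow>
        (\<lambda>n. measure (\<nu> n) (Pi\<^sub>E (cube d) A)) \<longlonglongrightarrow> measure \<rho> (Pi\<^sub>E (cube d) A))"

text \<open>The off-diagonal joining with parameter \<open>t\<close> is realised as an image measure; its defining values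
  on product sets are established in \<open>emeasure_offdiag_PiE\<close>, and they determine it by
  \<open>offdiag_unique\<close>.\<close>

definition offdiag ::
    "nat \<Rightarrow> 'x measure \<Rightarrow> (real \<Rightarrow> 'x \<Rightarrow> 'x) \<Rightarrow> ((nat \<Rightarrow> nat) \<Rightarrow> real) \<Rightarrow> ((nat \<Rightarrow> nat) \<Rightarrow> 'x) measure"
  where "offdiag d M T t = distr M (cube_space d M) (\<lambda>x. \<lambda>\<epsilon>\<in>cube d. T (coord d t \<epsilon>) x)"

text \<open>The setwise integral of a family of measures on the cube space.\<close>

definition integral_joining ::
    "nat \<Rightarrow> 'x measure \<Rightarrow> ((nat \<Rightarrow> nat) \<Rightarrow> real) measure \<Rightarrow>
      (((nat \<Rightarrow> nat) \<Rightarrow> real) \<Rightarrow> ((nat \<Rightarrow> nat) \<Rightarrow> 'x) measure) \<Rightarrow> ((nat \<Rightarrow> nat) \<Rightarrow> 'x) measure"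
  where "integral_joining d M Q \<nu> =
    measure_of (space (cube_space d M)) (sets (cube_space d M))
      (\<lambda>C. \<integral>\<^sup>+t. emeasure (\<nu> t) C \<partial>Q)"


subsection \<open>Consistency of the definitions\<close>

lemma finite_cube [simp]: "finite (cube d)"
  by (simp add: cube_def finite_PiE)

lemma zero_vertex_in_cube [simp]: "zero_vertex d \<in> cube d"
  by (auto simp: cube_def zero_vertex_def)

lemma measurable_coord:
  assumes "\<epsilon> \<in> cube d"
  shows "(\<lambda>t. coord d t \<epsilon>) \<in> borel_measurable (param_space d)"
proof (cases "\<epsilon> = zero_vertex d")
  case False
  then have "\<epsilon> \<in> pcube d" using assms by (simp add: pcube_def)
  then show ?thesis using False by (simp add: coord_def)
qed (simp add: coord_def)

lemma measurable_theta: "theta d \<in> param_space d \<rightarrow>\<^sub>M param_space d"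
proof -
  have "one_vertex d \<in> cube d" "\<epsilon> \<in> pcube d \<Longrightarrow> opposite d \<epsilon> \<in> cube d" for \<epsilon>
    by (auto simp: one_vertex_def opposite_def cube_def)
  then show ?thesis
    unfolding theta_def
    by (intro measurable_restrict borel_measurable_diff measurable_coord)
qed

lemma sets_offdiag [simp, measurable_cong]: "sets (offdiag d M T t) = sets (cube_space d M)"
  by (simp add: offdiag_def)

context mp_flow
begin

lemma measurable_T [measurable]: "T t \<in> M \<rightarrow>\<^sub>M M"
  using measurable_compose[OF measurable_Pair1' measurable_flow, of t] by simp

lemma T_in_space: "x \<in> space M \<Longrightarrow> T t x \<in> space M"
  using measurable_T by (rule measurable_space)

lemma flow_inverse: "x \<in> space M \<Longrightarrow> T (- t) (T t x) = x" "x \<in> space M \<Longrightarrow> T t (T (- t) x) = x"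
  using flow_add[of x "- t" t] flow_add[of x t "- t"] by (simp_all add: flow_0)

lemma vimage_T_eq_image: "A \<subseteq> space M \<Longrightarrow> T t -` A \<inter> space M = T (- t) ` A"
  using T_in_space flow_inverse by (auto simp: image_iff subset_eq) metis+

lemma measurable_offdiag_map [measurable]:
  "(\<lambda>x. \<lambda>\<epsilon>\<in>cube d. T (coord d t \<epsilon>) x) \<in> M \<rightarrow>\<^sub>M cube_space d M"
  by (intro measurable_restrict) auto

lemma emeasure_offdiag_PiE:
  assumes "\<And>\<epsilon>. \<epsilon> \<in> cube d \<Longrightarrow> A \<epsilon> \<in> sets M"
  shows "emeasure (offdiag d M T t) (Pi\<^sub>E (cube d) A) =
         emeasure M (\<Inter>\<epsilon>\<in>cube d. T (- coord d t \<epsilon>) ` A \<epsilon>)"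
proof -
  have "(\<lambda>x. \<lambda>\<epsilon>\<in>cube d. T (coord d t \<epsilon>) x) -` Pi\<^sub>E (cube d) A \<inter> space M =
        (\<Inter>\<epsilon>\<in>cube d. T (coord d t \<epsilon>) -` A \<epsilon> \<inter> space M)"
    using zero_vertex_in_cube[of d] by (auto simp del: zero_vertex_in_cube)
  also have "\<dots> = (\<Inter>\<epsilon>\<in>cube d. T (- coord d t \<epsilon>) ` A \<epsilon>)"
    using assms sets.sets_into_space by (intro INF_cong refl vimage_T_eq_image) auto
  finally show ?thesis
    using assms unfolding offdiag_def by (subst emeasure_distr) (auto intro!: sets_PiM_I_finite)
qed

lemma offdiag_unique:
  assumes "sets \<nu> = sets (cube_space d M)"
    and "\<And>A. (\<And>\<epsilon>. \<epsilon> \<in> cube d \<Longrightarrow> A \<epsilon> \<in> sets M) \<Longrightarrow>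
           emeasure \<nu> (Pi\<^sub>E (cube d) A) = emeasure M (\<Inter>\<epsilon>\<in>cube d. T (- coord d t \<epsilon>) ` A \<epsilon>)"
  shows "\<nu> = offdiag d M T t"
proof (rule measure_eqI_PiM_finite[where I="cube d" and M="\<lambda>_. M" and A="\<lambda>_. space (cube_space d M)"])
  show "range (\<lambda>_::nat. space (cube_space d M)) \<subseteq> prod_algebra (cube d) (\<lambda>_. M)"
    by (auto simp: space_PiM intro!: prod_algebraI_finite)
  show "emeasure \<nu> (space (cube_space d M)) \<noteq> \<infinity>" for i :: nat
    unfolding space_PiM by (subst assms(2)) (auto simp: emeasure_eq_measure)
qed (use assms in \<open>auto simp: emeasure_offdiag_PiE\<close>)

lemma prob_space_offdiag: "prob_space (offdiag d M T t)"
  unfolding offdiag_def by (rule prob_space_distr) simp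

lemma measurable_diagonal_flow [measurable]:
  "diagonal_flow d T t \<in> cube_space d M \<rightarrow>\<^sub>M cube_space d M"
  unfolding diagonal_flow_def by (intro measurable_restrict) auto

lemma offdiag_in_joinings: "offdiag d M T t \<in> joinings d M T"
proof -
  let ?f = "\<lambda>x. \<lambda>\<epsilon>\<in>cube d. T (coord d t \<epsilon>) x"
  have "distr (offdiag d M T t) (cube_space d M) (diagonal_flow d T s) = offdiag d M T t" for s
  proof -
    have *: "diagonal_flow d T s (?f x) = ?f (T s x)" if "x \<in> space M" for x
      using that flow_add[of x s] flow_add[of x _ s]
      by (auto simp: diagonal_flow_def fun_eq_iff add.commute)
    have "distr (offdiag d M T t) (cube_space d M) (diagonal_flow d T s) =
          distr M (cube_space d M) (diagonal_flow d T s \<circ> ?f)"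
      unfolding offdiag_def by (rule distr_distr) measurable
    also have "\<dots> = distr M (cube_space d M) (?f \<circ> T s)"
      using * by (intro distr_cong) auto
    also have "\<dots> = distr (distr M M (T s)) (cube_space d M) ?f"
      by (rule distr_distr[symmetric]) measurable
    also have "\<dots> = offdiag d M T t"
      by (simp add: flow_preserving offdiag_def)
    finally show ?thesis .
  qed
  moreover have "distr (offdiag d M T t) M (\<lambda>x. x \<epsilon>) = M" if \<epsilon>: "\<epsilon> \<in> cube d" for \<epsilon>
  proof -
    have "distr (offdiag d M T t) M (\<lambda>x. x \<epsilon>) = distr M M ((\<lambda>x. x \<epsilon>) \<circ> ?f)"
      unfolding offdiag_def using \<epsilon> by (intro distr_distr) measurable
    also have "\<dots> = distr M M (T (coord d t \<epsilon>))"
      using \<epsilon> by (intro distr_cong) auto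
    finally show ?thesis by (simp add: flow_preserving)
  qed
  ultimately show ?thesis
    by (simp add: joinings_def prob_space_offdiag)
qed

text \<open>Setwise integrals of a measurable family of joinings are again joinings.\<close>

lemma emeasure_integral_joining:
  assumes "\<And>t. sets (\<nu> t) = sets (cube_space d M)"
    and "\<And>C. C \<in> sets (cube_space d M) \<Longrightarrow> (\<lambda>t. emeasure (\<nu> t) C) \<in> borel_measurable Q"
    and "C \<in> sets (cube_space d M)"
  shows "emeasure (integral_joining d M Q \<nu>) C = (\<integral>\<^sup>+t. emeasure (\<nu> t) C \<partial>Q)"
proof (rule emeasure_measure_of[OF integral_joining_def])
  show "countably_additive (sets (integral_joining d M Q \<nu>)) (\<lambda>C. \<integral>\<^sup>+t. emeasure (\<nu> t) C \<partial>Q)"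
  proof (rule countably_additiveI)
    fix A :: "nat \<Rightarrow> _" assume A: "range A \<subseteq> sets (integral_joining d M Q \<nu>)" "disjoint_family A"
    then have A': "A i \<in> sets (cube_space d M)" for i
      by (auto simp: integral_joining_def)
    have "(\<Sum>i. \<integral>\<^sup>+t. emeasure (\<nu> t) (A i) \<partial>Q) = (\<integral>\<^sup>+t. (\<Sum>i. emeasure (\<nu> t) (A i)) \<partial>Q)"
      using assms(2) A' by (intro nn_integral_suminf[symmetric]) auto
    also have "\<dots> = (\<integral>\<^sup>+t. emeasure (\<nu> t) (\<Union>i. A i) \<partial>Q)"
      using A A' assms(1) by (intro nn_integral_cong suminf_emeasure) auto
    finally show "(\<Sum>i. \<integral>\<^sup>+t. emeasure (\<nu> t) (A i) \<partial>Q) = (\<integral>\<^sup>+t. emeasure (\<nu> t) (\<Union>i. A i) \<partial>Q)" .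
  qed
qed (use assms in \<open>auto simp: integral_joining_def positive_def sets.space_closed\<close>)

lemma integral_joining_in_joinings:
  assumes "prob_space Q"
    and \<nu>: "\<And>t. \<nu> t \<in> joinings d M T"
    and meas: "\<And>C. C \<in> sets (cube_space d M) \<Longrightarrow> (\<lambda>t. emeasure (\<nu> t) C) \<in> borel_measurable Q"
  shows "integral_joining d M Q \<nu> \<in> joinings d M T"
proof -
  interpret Q: prob_space Q by fact
  let ?J = "integral_joining d M Q \<nu>"
  have sets_\<nu>: "sets (\<nu> t) = sets (cube_space d M)"
    and inv: "distr (\<nu> t) (cube_space d M) (diagonal_flow d T s) = \<nu> t"
    and marg: "\<epsilon> \<in> cube d \<Longrightarrow> distr (\<nu> t) M (\<lambda>x. x \<epsilon>) = M"
    and prob: "prob_space (\<nu> t)" for t s \<epsilon>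
    using \<nu>[of t] by (auto simp: joinings_def)
  have space_\<nu>: "space (\<nu> t) = space (cube_space d M)" for t
    using sets_\<nu> by (rule sets_eq_imp_space_eq)
  have sets_J: "sets ?J = sets (cube_space d M)"
    by (simp add: integral_joining_def)
  have space_J: "space ?J = space (cube_space d M)"
    using sets_J by (rule sets_eq_imp_space_eq)
  note em = emeasure_integral_joining[OF sets_\<nu> meas]
  have 1: "prob_space ?J"
  proof
    show "emeasure ?J (space ?J) = 1"
      using prob_space.emeasure_space_1[OF prob]
      by (simp add: em space_J flip: space_\<nu>) (simp add: em space_\<nu> Q.emeasure_space_1)
  qed
  have 2: "distr ?J (cube_space d M) (diagonal_flow d T s) = ?J" for s
  proof (rule measure_eqI)
    fix C assume "C \<in> sets (distr ?J (cube_space d M) (diagonal_flow d T s))"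
    then have C: "C \<in> sets (cube_space d M)" by simp
    let ?D = "diagonal_flow d T s -` C \<inter> space (cube_space d M)"
    have D: "?D \<in> sets (cube_space d M)" using C by (intro measurable_sets) auto
    have m: "diagonal_flow d T s \<in> N \<rightarrow>\<^sub>M cube_space d M" if "sets N = sets (cube_space d M)" for N
      using measurable_diagonal_flow measurable_cong_sets[OF that refl] by blast
    have "emeasure (\<nu> t) ?D = emeasure (\<nu> t) C" for t
      using C emeasure_distr[OF m[OF sets_\<nu>] C] by (simp add: inv space_\<nu>)
    then show "emeasure (distr ?J (cube_space d M) (diagonal_flow d T s)) C = emeasure ?J C"
      using C D by (subst emeasure_distr[OF m[OF sets_J]]) (simp_all add: space_J em)
  qed (simp add: sets_J)
  have 3: "distr ?J M (\<lambda>x. x \<epsilon>) = M" if \<epsilon>: "\<epsilon> \<in> cube d" for \<epsilon>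
  proof (rule measure_eqI)
    fix C assume "C \<in> sets (distr ?J M (\<lambda>x. x \<epsilon>))"
    then have C: "C \<in> sets M" by simp
    let ?D = "(\<lambda>x. x \<epsilon>) -` C \<inter> space (cube_space d M)"
    have D: "?D \<in> sets (cube_space d M)"
      using C \<epsilon> by (intro measurable_sets[OF measurable_component_singleton]) auto
    have m: "(\<lambda>x. x \<epsilon>) \<in> N \<rightarrow>\<^sub>M M" if "sets N = sets (cube_space d M)" for N
      using measurable_component_singleton[OF \<epsilon>, of "\<lambda>_. M"] measurable_cong_sets[OF that refl]
      by blast
    have "emeasure (\<nu> t) ?D = emeasure M C" for t
      using C emeasure_distr[OF m[OF sets_\<nu>] C] by (simp add: marg \<epsilon> space_\<nu>)
    then show "emeasure (distr ?J M (\<lambda>x. x \<epsilon>)) C = emeasure M C"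
      using C D by (subst emeasure_distr[OF m[OF sets_J]])
        (simp_all add: space_J em Q.emeasure_space_1)
  qed simp
  show ?thesis using 1 2 3 sets_J by (simp add: joinings_def)
qed

lemma measurable_emeasure_offdiag:
  assumes Q: "sets Q = sets (param_space d)" and C: "C \<in> sets (cube_space d M)"
  shows "(\<lambda>t. emeasure (offdiag d M T (\<lambda>\<epsilon>\<in>pcube d. - t \<epsilon>)) C) \<in> borel_measurable Q"
proof -
  let ?g = "\<lambda>t x. \<lambda>\<epsilon>\<in>cube d. T (coord d (\<lambda>\<epsilon>\<in>pcube d. - t \<epsilon>) \<epsilon>) x"
  have c: "(\<lambda>t. coord d (\<lambda>\<epsilon>\<in>pcube d. - t \<epsilon>) \<epsilon>) \<in> borel_measurable Q" if "\<epsilon> \<in> cube d" for \<epsilon>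
  proof (cases "\<epsilon> = zero_vertex d")
    case False
    then have "\<epsilon> \<in> pcube d" using that by (simp add: pcube_def)
    then show ?thesis
      using False measurable_component_singleton[of \<epsilon> "pcube d" "\<lambda>_. borel :: real measure"]
      unfolding measurable_cong_sets[OF Q refl] by (simp add: coord_def)
  qed (simp add: coord_def)
  have g: "(\<lambda>(t, x). ?g t x) \<in> Q \<Otimes>\<^sub>M M \<rightarrow>\<^sub>M cube_space d M"
    unfolding split_beta
  proof (intro measurable_restrict)
    fix \<epsilon> assume "\<epsilon> \<in> cube d"
    from c[OF this] have [measurable]: "(\<lambda>t. coord d (\<lambda>\<epsilon>\<in>pcube d. - t \<epsilon>) \<epsilon>) \<in> borel_measurable Q" .
    have "(\<lambda>p. (coord d (\<lambda>\<epsilon>\<in>pcube d. - fst p \<epsilon>) \<epsilon>, snd p)) \<in> Q \<Otimes>\<^sub>M M \<rightarrow>\<^sub>M borel \<Otimes>\<^sub>M M"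
      by (intro measurable_Pair measurable_compose[OF measurable_fst c[OF \<open>\<epsilon> \<in> cube d\<close>]] measurable_snd)
    from measurable_compose[OF this measurable_flow]
    show "(\<lambda>p. T (coord d (\<lambda>\<epsilon>\<in>pcube d. - fst p \<epsilon>) \<epsilon>) (snd p)) \<in> Q \<Otimes>\<^sub>M M \<rightarrow>\<^sub>M M" by simp
  qed
  let ?S = "(\<lambda>(t, x). ?g t x) -` C \<inter> space (Q \<Otimes>\<^sub>M M)"
  have "(\<lambda>t. emeasure M (Pair t -` ?S)) \<in> borel_measurable Q"
    using measurable_sets[OF g C] by (rule measurable_emeasure_Pair)
  moreover have "emeasure M (Pair t -` ?S) = emeasure (offdiag d M T (\<lambda>\<epsilon>\<in>pcube d. - t \<epsilon>)) C"
    if "t \<in> space Q" for t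
    unfolding offdiag_def using that C
    by (subst emeasure_distr) (auto intro!: arg_cong[where f="emeasure M"] simp: space_pair_measure)
  ultimately show ?thesis
    by (subst measurable_cong[of Q _ "\<lambda>t. emeasure M (Pair t -` ?S)"]) auto
qed

lemma integral_offdiag_in_joinings:
  assumes "prob_space Q" "sets Q = sets (param_space d)"
  shows "integral_joining d M Q (\<lambda>t. offdiag d M T (\<lambda>\<epsilon>\<in>pcube d. - t \<epsilon>)) \<in> joinings d M T"
  using assms by (intro integral_joining_in_joinings offdiag_in_joinings measurable_emeasure_offdiag)

end

end

theory Submission
  imports Defs
begin

text \<open>Suppose \<open>S\<close> conjugates \<open>T\<close> to its inverse. Applying \<open>S\<close> to every coordinate and permuting the
  vertices by \<open>\<epsilon> \<mapsto> 1 - \<epsilon>\<close> maps the off-diagonal joining with parameter \<open>t\<close> to the one with parameter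
  \<open>theta d t\<close>. Cube parameters \<open>vertex_sum d x\<close> are fixed by \<open>theta\<close>, so the approximating joinings, and
  hence their limit, are invariant under this map. Thus \<open>Q\<close> and its image under \<open>theta\<close> define the same
  integral of off-diagonal joinings, and it remains to see that such an integral determines the mixing
  measure.

  Ergodicity and aperiodicity imply that almost every point has trivial stabiliser. For such points the
  relation \<open>\<exists>s\<in>K. T s x = y\<close> detects whether the time between \<open>x\<close> and \<open>y\<close> lies in \<open>K\<close>, so it only has
  to be shown measurable for Borel \<open>K\<close>. This avoids the Lusin--Souslin theorem: the occupation times of
  countably many separating sets give a measurable injection of \<open>X\<close> into a countable power of the reals
  that is continuous along orbits, and for compact \<open>K\<close> the quantifier over \<open>K\<close> can then be replaced by one
  over a countable dense subset.\<close>

section \<open>Countable separation and replacement of a quantifier over a compact set\<close>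

text \<open>Balls of rational radius about a countable dense set do this: for distinct x and y take
  a centre c closer to x than half their distance and a radius in between. The ball contains x and,
  by the triangle inequality, not y.\<close>

lemma standard_borel_separating:
  assumes "standard_borel M"
  obtains E :: "nat \<Rightarrow> 'x set" where "\<And>k. E k \<in> sets M"
    and "\<And>x y. x \<in> space M \<Longrightarrow> y \<in> space M \<Longrightarrow> (\<And>k. x \<in> E k \<longleftrightarrow> y \<in> E k) \<Longrightarrow> x = y"
proof -
  obtain X where X: "completely_metrizable_space X" "separable_space X" "topspace X = space M"
    "sets M = sigma_sets (topspace X) {U. openin X U}"
    using assms by (auto simp: standard_borel_def)
  from X(1) obtain S d where "Metric_space S d" and Xd: "X = Metric_space.mtopology S d"
    by (auto simp: completely_metrizable_space_def)
  then interpret Metric_space S d by simp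
  have S: "S = space M" using X(3) Xd by simp
  obtain C where C: "countable C" "C \<subseteq> S" "mtopology closure_of C = S"
    using X(2) by (auto simp: separable_space_def Xd)
  \<comment> \<open>The empty set is added so that the family is nonempty and
    \<open>from_nat_into\<close> enumerates exactly it, even over an empty space.\<close>
  define \<B> where "\<B> = insert {} ((\<lambda>(c, r). mball c r) ` (C \<times> \<rat>))"
  have "countable (C \<times> (\<rat> :: real set))" using C(1) countable_rat by (rule countable_SIGMA)
  then have "countable \<B>" unfolding \<B>_def by (intro countable_insert countable_image)
  moreover have "\<B> \<noteq> {}" by (simp add: \<B>_def)
  ultimately have range: "range (from_nat_into \<B>) = \<B>"
    by (simp add: range_from_nat_into)
  show thesis
  proof
    fix k
    have "from_nat_into \<B> k \<in> \<B>" using \<open>\<B> \<noteq> {}\<close> by (rule from_nat_into)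
    then have "openin X (from_nat_into \<B> k)"
      unfolding Xd \<B>_def by (elim insertE) (simp, elim imageE, simp add: split_beta openin_mball)
    then show "from_nat_into \<B> k \<in> sets M"
      unfolding X(4) by (intro sigma_sets.Basic) simp
  next
    fix x y assume xy: "x \<in> space M" "y \<in> space M"
      and eq: "\<And>k. x \<in> from_nat_into \<B> k \<longleftrightarrow> y \<in> from_nat_into \<B> k"
    have eq': "x \<in> B \<longleftrightarrow> y \<in> B" if "B \<in> \<B>" for B
    proof -
      have "B \<in> range (from_nat_into \<B>)" using that by (simp only: range)
      then obtain k where "B = from_nat_into \<B> k" by blast
      then show ?thesis using eq by simp
    qed
    show "x = y"
    proof (rule ccontr)
      assume "x \<noteq> y"
      have xyS: "x \<in> S" "y \<in> S" using xy S by auto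
      then have pos: "d x y / 2 > 0" using \<open>x \<noteq> y\<close> by simp
      have "x \<in> mtopology closure_of C" using C(3) xyS by simp
      then have "\<exists>c\<in>C. c \<in> mball x (d x y / 2)"
        using pos unfolding metric_closure_of by blast
      then obtain c where c: "c \<in> C" "c \<in> S" "d c x < d x y / 2"
        by (auto simp: commute)
      obtain r where r: "r \<in> \<rat>" "d c x < r" "r < d x y / 2"
        using Rats_dense_in_real[OF c(3)] by auto
      have "mball c r \<in> \<B>" using c r by (auto simp: \<B>_def)
      moreover have "x \<in> mball c r" using c xyS r by simp
      ultimately have "y \<in> mball c r" using eq' by blast
      then have "d c y < r" by simp
      then show False
        using triangle[of x c y] c xyS r commute[of x c] by simp
    qed
  qed
qed

lemma continuous_on_real_lipschitzI:
  fixes f :: "real \<Rightarrow> real"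
  assumes "\<And>a b. a \<le> b \<Longrightarrow> \<bar>f a - f b\<bar> \<le> b - a"
  shows "continuous_on UNIV f"
proof -
  have "\<bar>f a - f b\<bar> \<le> \<bar>a - b\<bar>" for a b
    using assms[of a b] assms[of b a] by (cases "a \<le> b") auto
  then have "1-lipschitz_on UNIV f"
    by (intro lipschitz_onI) (auto simp: dist_real_def)
  then show ?thesis by (rule lipschitz_on_continuous_on)
qed

text \<open>For countable \<open>D\<close> this makes the condition accessible to measurability.
  Density and continuity give small values on \<open>D\<close>; conversely the minimum of
  \<open>f\<close> over \<open>K\<close> is attained and lies below every
  \<open>1 / Suc n\<close>.\<close>

lemma exists_zero_iff_dense_small:
  fixes f :: "real \<Rightarrow> real"
  assumes K: "compact K" and D: "D \<subseteq> K" "K \<subseteq> closure D"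
    and f: "continuous_on K f" "\<And>t. t \<in> K \<Longrightarrow> f t \<ge> 0"
  shows "(\<exists>t\<in>K. f t = 0) \<longleftrightarrow> (\<forall>n. \<exists>t\<in>D. f t < 1 / Suc n)"
proof
  assume "\<exists>t\<in>K. f t = 0"
  then obtain t where t: "t \<in> K" "f t = 0" by auto
  show "\<forall>n. \<exists>t\<in>D. f t < 1 / Suc n"
  proof
    fix n :: nat
    obtain e where e: "e > 0" "\<And>s. s \<in> K \<Longrightarrow> dist s t < e \<Longrightarrow> dist (f s) (f t) < 1 / Suc n"
      using f(1) t(1) unfolding continuous_on_iff by (metis of_nat_0_less_iff zero_less_Suc zero_less_divide_1_iff)
    obtain s where s: "s \<in> D" "dist s t < e"
      using D(2) t(1) e(1) closure_approachable by blast
    then have "f s < 1 / Suc n"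
      using e(2)[of s] D(1) t(2) by (auto simp: dist_real_def)
    then show "\<exists>t\<in>D. f t < 1 / Suc n" using s(1) by blast
  qed
next
  assume small: "\<forall>n. \<exists>t\<in>D. f t < 1 / Suc n"
  then have "K \<noteq> {}" using D(1) by blast
  then obtain t where t: "t \<in> K" "\<And>s. s \<in> K \<Longrightarrow> f t \<le> f s"
    using continuous_attains_inf[OF K _ f(1)] by auto
  have "f t < 1 / Suc n" for n
    using small t(2) D(1) by (metis le_less_trans subset_eq)
  then have "f t \<le> 0"
    using nat_approx_posE[of "f t"] by (metis less_le_not_le linorder_not_le)
  then show "\<exists>t\<in>K. f t = 0" using f(2) t(1) by force
qed

subsection \<open>Occupation times along orbits\<close>

context mp_flow
begin

lemma measurable_orbit: "x \<in> space M \<Longrightarrow> (\<lambda>s. T s x) \<in> borel \<rightarrow>\<^sub>M M"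
  using measurable_compose[OF measurable_Pair2' measurable_flow, of x] by simp

text \<open>Integrating the indicator of \<open>E\<close> over time gives continuity along orbits.
  Varying the left endpoint \<open>r\<close> recovers the set of visit times in
  \<open>{0<..1}\<close> up to a null set.\<close>

definition occupation :: "'x set \<Rightarrow> real \<Rightarrow> 'x \<Rightarrow> real" where
  "occupation E r x = measure lborel {s \<in> {r<..1}. T s x \<in> E}"

lemma visits_in_sets:
  assumes "x \<in> space M" "E \<in> sets M" "B \<in> sets borel"
  shows "{s \<in> B. T s x \<in> E} \<in> sets borel"
  using sets.Int[OF assms(3) measurable_sets[OF measurable_orbit[OF assms(1)] assms(2)]]
  by (simp add: Int_def)

lemma measurable_occupation:
  assumes "E \<in> sets M"
  shows "occupation E r \<in> borel_measurable M"
proof -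
  have flow: "(\<lambda>p. T (snd p) (fst p)) \<in> M \<Otimes>\<^sub>M lborel \<rightarrow>\<^sub>M M"
    using measurable_compose[OF _ measurable_flow, of "\<lambda>p. (snd p, fst p)" "M \<Otimes>\<^sub>M lborel"] by simp
  define V where "V = (\<lambda>p. T (snd p) (fst p)) -` E \<inter> space (M \<Otimes>\<^sub>M lborel) \<inter> space M \<times> {r<..1}"
  have "V \<in> sets (M \<Otimes>\<^sub>M lborel)"
    unfolding V_def by (intro sets.Int measurable_sets[OF flow assms] pair_measureI) auto
  then have "(\<lambda>x. enn2real (emeasure lborel (Pair x -` V))) \<in> borel_measurable M"
    by (intro measurable_compose[OF lborel.measurable_emeasure_Pair]) auto
  moreover have "occupation E r x = enn2real (emeasure lborel (Pair x -` V))" if "x \<in> space M" for x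
  proof -
    have "Pair x -` V = {s \<in> {r<..1}. T s x \<in> E}"
      using that by (auto simp: V_def space_pair_measure)
    then show ?thesis by (simp add: occupation_def measure_def)
  qed
  ultimately show ?thesis
    by (subst measurable_cong)
qed

text \<open>\<open>{a<..b}\<close> is covered by \<open>{a'<..b'}\<close> and
  \<open>{a<..a'}\<close>, and \<open>{a'<..b'}\<close> by \<open>{a<..b}\<close> and
  \<open>{b<..b'}\<close>. This serves both for shifting a window and for moving only its left
  endpoint.\<close>

lemma measure_visits_lipschitz:
  assumes x: "x \<in> space M" and E: "E \<in> sets M" and "a \<le> a'" "b \<le> b'"
  shows "measure lborel {s \<in> {a<..b}. T s x \<in> E} \<le> measure lborel {s \<in> {a'<..b'}. T s x \<in> E} + (a' - a)"
    and "measure lborel {s \<in> {a'<..b'}. T s x \<in> E} \<le> measure lborel {s \<in> {a<..b}. T s x \<in> E} + (b' - b)"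
proof -
  note m = visits_in_sets[OF x E]
  have fin': "{a<..b} \<in> fmeasurable lborel" for a b :: real
    by (cases "a \<le> b") (simp_all add: fmeasurable_def)
  have fin: "{s \<in> {a<..b}. T s x \<in> E} \<in> fmeasurable lborel" for a b
    using m[of "{a<..b}"] by (intro fmeasurableI2[OF fin']) auto
  have "measure lborel {s \<in> {a<..b}. T s x \<in> E}
      \<le> measure lborel ({s \<in> {a'<..b'}. T s x \<in> E} \<union> {a<..a'})"
    using assms by (intro measure_mono_fmeasurable) (use m[of "{a<..b}"] m[of "{a'<..b'}"] in \<open>auto intro!: fmeasurable.Un fin[simplified] fin'\<close>)
  also have "\<dots> \<le> measure lborel {s \<in> {a'<..b'}. T s x \<in> E} + measure lborel {a<..a'}"
    by (intro measure_Un_le) (use m[of "{a'<..b'}"] in auto)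
  finally show "measure lborel {s \<in> {a<..b}. T s x \<in> E}
      \<le> measure lborel {s \<in> {a'<..b'}. T s x \<in> E} + (a' - a)" using assms by simp
  have "measure lborel {s \<in> {a'<..b'}. T s x \<in> E}
      \<le> measure lborel ({s \<in> {a<..b}. T s x \<in> E} \<union> {b<..b'})"
    using assms by (intro measure_mono_fmeasurable) (use m[of "{a<..b}"] m[of "{a'<..b'}"] in \<open>auto intro!: fmeasurable.Un fin[simplified] fin'\<close>)
  also have "\<dots> \<le> measure lborel {s \<in> {a<..b}. T s x \<in> E} + measure lborel {b<..b'}"
    by (intro measure_Un_le) (use m[of "{a<..b}"] in auto)
  finally show "measure lborel {s \<in> {a'<..b'}. T s x \<in> E}
      \<le> measure lborel {s \<in> {a<..b}. T s x \<in> E} + (b' - b)" using assms by simp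
qed

lemma occupation_flow:
  assumes x: "x \<in> space M" and E: "E \<in> sets M"
  shows "occupation E r (T t x) = measure lborel {s \<in> {r + t<..1 + t}. T s x \<in> E}"
proof -
  let ?V = "{s \<in> {r + t<..1 + t}. T s x \<in> E}"
  have "measure lborel ?V = measure (distr lborel borel ((+) t)) ?V"
    by (simp only: lborel_distr_plus)
  also have "\<dots> = measure lborel ((+) t -` ?V \<inter> space lborel)"
    using visits_in_sets[OF x E] by (intro measure_distr) auto
  also have "(+) t -` ?V \<inter> space lborel = {s \<in> {r<..1}. T s (T t x) \<in> E}"
    using flow_add[OF x] by (auto simp: add.commute)
  finally show ?thesis by (simp add: occupation_def)
qed

lemma continuous_occupation_flow:
  assumes x: "x \<in> space M" and E: "E \<in> sets M"
  shows "continuous_on UNIV (\<lambda>t. occupation E r (T t x))"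
proof (rule continuous_on_real_lipschitzI)
  fix a b :: real assume "a \<le> b"
  then show "\<bar>occupation E r (T a x) - occupation E r (T b x)\<bar> \<le> b - a"
    using measure_visits_lipschitz[OF x E, of "r + a" "r + b" "1 + a" "1 + b"]
    by (simp add: occupation_flow[OF x E])
qed

text \<open>Occupation times are the masses of half-lines under Lebesgue measure restricted to the
  visit times, and half-lines determine such a measure.\<close>

lemma occupation_eq_imp_AE:
  assumes x: "x \<in> space M" and y: "y \<in> space M" and E: "E \<in> sets M"
    and eq: "\<And>r. r \<in> \<rat> \<Longrightarrow> occupation E r x = occupation E r y"
  shows "AE s in lborel. s \<in> {0<..1} \<longrightarrow> (T s x \<in> E \<longleftrightarrow> T s y \<in> E)"
proof -
  have cont: "continuous_on UNIV (\<lambda>r. occupation E r z)" if z: "z \<in> space M" for z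
  proof (rule continuous_on_real_lipschitzI)
    fix a b :: real assume "a \<le> b"
    then show "\<bar>occupation E a z - occupation E b z\<bar> \<le> b - a"
      using measure_visits_lipschitz[OF z E, of a b 1 1] by (simp add: occupation_def)
  qed
  \<comment> \<open>Occupation time is continuous in \<open>r\<close>, so equality extends from
    rational to real endpoints.\<close>
  have "continuous_on (closure \<rat>) (\<lambda>r. occupation E r x - occupation E r y)"
    unfolding Rats_closure_real using cont x y by (intro continuous_intros)
  then have eq': "occupation E r x = occupation E r y" for r
    using continuous_constant_on_closure[of \<rat> "\<lambda>r. occupation E r x - occupation E r y" 0 r] eq
    by (simp add: Rats_closure_real)
  define V where "V z = {s \<in> {0<..1}. T s z \<in> E}" for z
  have V: "V z \<in> sets borel" if "z \<in> space M" for z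
    unfolding V_def using visits_in_sets[OF that E] by simp
  have tail: "V z \<inter> {r<..} = {s \<in> {max 0 r<..1}. T s z \<in> E}" for z r
    by (auto simp: V_def)
  have fin: "V z \<inter> {r<..} \<in> fmeasurable lborel" if "z \<in> space M" for z r
    using V[OF that] by - (rule fmeasurableI2[of "{0..1}"], auto simp: V_def fmeasurable_def)
  have em: "emeasure (density lborel (indicator (V z))) B = emeasure lborel (V z \<inter> B)"
    if "z \<in> space M" "B \<in> sets borel" for z B
    using V[OF that(1)] that(2) by (subst emeasure_restricted) auto
  have "density lborel (indicator (V x)) = density lborel (indicator (V y))"
  proof (rule measure_eqI_lessThan)
    fix r :: real
    show "emeasure (density lborel (indicator (V x))) {r<..} < \<infinity>"
      using fin[OF x] by (simp add: em x fmeasurable_def)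
    show "emeasure (density lborel (indicator (V x))) {r<..} =
          emeasure (density lborel (indicator (V y))) {r<..}"
      using fin[OF x] fin[OF y] eq'[of "max 0 r"]
      by (simp add: em x y emeasure_eq_measure2 tail occupation_def)
  qed simp_all
  \<comment> \<open>The equal measures are tested on both differences: one side gives the measure of
    the difference, the other that of the empty set.\<close>
  then have "emeasure lborel (V x \<inter> (V x - V y)) = emeasure lborel (V y \<inter> (V x - V y))"
    "emeasure lborel (V x \<inter> (V y - V x)) = emeasure lborel (V y \<inter> (V y - V x))"
    using V x y by (simp_all only: em[symmetric] sets.Diff)
  moreover have "V x \<inter> (V x - V y) = V x - V y" "V y \<inter> (V x - V y) = {}"
    "V x \<inter> (V y - V x) = {}" "V y \<inter> (V y - V x) = V y - V x" by auto
  ultimately have "V x - V y \<in> null_sets lborel" "V y - V x \<in> null_sets lborel"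
    using V x y by (auto intro!: null_setsI)
  from this[THEN AE_not_in] show ?thesis
    by eventually_elim (auto simp: V_def)
qed

text \<open>Countably many null sets of times are discarded together. As \<open>{0<..1}\<close> is
  not null, some time \<open>s\<close> remains at which both orbits lie in the same sets
  \<open>E k\<close>; then \<open>T s x = T s y\<close>, and \<open>T (- s)\<close> undoes the
  shift.\<close>

lemma occupations_separate:
  assumes E: "\<And>k :: nat. E k \<in> sets M"
    and sep: "\<And>x y. x \<in> space M \<Longrightarrow> y \<in> space M \<Longrightarrow> (\<And>k. x \<in> E k \<longleftrightarrow> y \<in> E k) \<Longrightarrow> x = y"
    and x: "x \<in> space M" and y: "y \<in> space M"
    and eq: "\<And>k r. r \<in> \<rat> \<Longrightarrow> occupation (E k) r x = occupation (E k) r y"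
  shows "x = y"
proof -
  have "AE s in lborel. \<forall>k. s \<in> {0<..1} \<longrightarrow> (T s x \<in> E k \<longleftrightarrow> T s y \<in> E k)"
    unfolding AE_all_countable using occupation_eq_imp_AE[OF x y E eq] by simp
  then obtain N where N: "N \<in> null_sets lborel"
    "{s. \<not> (\<forall>k. s \<in> {0<..1} \<longrightarrow> (T s x \<in> E k \<longleftrightarrow> T s y \<in> E k))} \<subseteq> N"
    by (auto simp: eventually_ae_filter)
  have "\<not> {0<..1::real} \<subseteq> N"
  proof
    assume "{0<..1::real} \<subseteq> N"
    then have "{0<..1::real} \<in> null_sets lborel" using N(1) by (rule null_sets_subset[rotated 2]) simp
    then show False by (auto simp: null_sets_def)
  qed
  then obtain s where s: "s \<in> {0<..1}" "s \<notin> N" by blast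
  then have "T s x = T s y" using N(2) x y by (intro sep T_in_space) auto
  then have "T (- s) (T s x) = T (- s) (T s y)" by simp
  then show ?thesis using flow_inverse x y by simp
qed

text \<open>The flow is merely measurable, so its orbits need not be continuous in a given Polish
  topology; occupation times supply the continuity. With a countable index set, measurability can be
  checked coordinatewise and the target carries a metric.\<close>

lemma orbit_continuous_embedding:
  assumes "standard_borel M"
  obtains h :: "'x \<Rightarrow> nat \<times> rat \<Rightarrow> real"
  where "h \<in> borel_measurable M" "inj_on h (space M)"
    "\<And>x. x \<in> space M \<Longrightarrow> continuous_on UNIV (\<lambda>t. h (T t x))"
proof -
  obtain E :: "nat \<Rightarrow> 'x set" where E: "\<And>k. E k \<in> sets M"
    and sep: "\<And>x y. x \<in> space M \<Longrightarrow> y \<in> space M \<Longrightarrow> (\<And>k. x \<in> E k \<longleftrightarrow> y \<in> E k) \<Longrightarrow> x = y"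
    using standard_borel_separating[OF assms] by blast
  let ?h = "\<lambda>x (k, r). occupation (E k) (of_rat r) x"
  show thesis
  proof
    show "?h \<in> borel_measurable M"
      by (intro measurable_coordinatewise_then_product) (auto intro!: measurable_occupation E split: prod.split)
    show "inj_on ?h (space M)"
    proof (rule inj_onI)
      fix x y assume xy: "x \<in> space M" "y \<in> space M" and "?h x = ?h y"
      then have "?h x (k, r) = ?h y (k, r)" for k r by metis
      then show "x = y"
        by (intro occupations_separate[of E x y, OF E sep xy]) (auto simp: Rats_def)
    qed
    show "continuous_on UNIV (\<lambda>t. ?h (T t x))" if "x \<in> space M" for x
      by (intro continuous_on_coordinatewise_then_product)
        (auto intro!: continuous_occupation_flow E that split: prod.split)
  qed
qed

subsection \<open>Free points and the orbit relation\<close>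


text \<open>As \<open>h\<close> is injective, \<open>T t x = y\<close> means that
  \<open>h (T t x)\<close> and \<open>h y\<close> have distance zero. This distance is continuous in
  \<open>t\<close>, so a countable dense set of times in \<open>K\<close> decides.\<close>

lemma sets_orbit_graph_compact:
  assumes "standard_borel M" and K: "compact K"
  shows "{p \<in> space (M \<Otimes>\<^sub>M M). \<exists>t\<in>K. T t (fst p) = snd p} \<in> sets (M \<Otimes>\<^sub>M M)"
proof -
  obtain h :: "'x \<Rightarrow> nat \<times> rat \<Rightarrow> real" where h [measurable]: "h \<in> borel_measurable M"
    and inj: "inj_on h (space M)"
    and cont: "\<And>x. x \<in> space M \<Longrightarrow> continuous_on UNIV (\<lambda>t. h (T t x))"
    using orbit_continuous_embedding[OF assms(1)] by blast
  obtain D where D: "countable D" "D \<subseteq> K" "K \<subseteq> closure D"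
    using separable[of K] by blast
  have "(\<exists>t\<in>K. T t (fst p) = snd p) \<longleftrightarrow>
      (\<forall>n. \<exists>t\<in>D. dist (h (T t (fst p))) (h (snd p)) < 1 / Suc n)"
    if p: "p \<in> space (M \<Otimes>\<^sub>M M)" for p
  proof -
    have p': "fst p \<in> space M" "snd p \<in> space M" using p by (auto simp: space_pair_measure)
    then have "T t (fst p) = snd p \<longleftrightarrow> dist (h (T t (fst p))) (h (snd p)) = 0" for t
      using inj T_in_space by (auto simp: inj_on_eq_iff)
    then show ?thesis
      by (subst exists_zero_iff_dense_small[OF K D(2,3), symmetric])
        (simp_all add: continuous_on_dist continuous_on_subset[OF cont[OF p'(1)]])
  qed
  then have "{p \<in> space (M \<Otimes>\<^sub>M M). \<exists>t\<in>K. T t (fst p) = snd p} =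
      {p \<in> space (M \<Otimes>\<^sub>M M). \<forall>n. \<exists>t\<in>D. dist (h (T t (fst p))) (h (snd p)) < 1 / Suc n}"
    by blast
  also have "\<dots> \<in> sets (M \<Otimes>\<^sub>M M)"
    using D(1) by measurable
  finally show ?thesis .
qed

lemma sets_return_within:
  assumes "standard_borel M" "compact K"
  shows "{x \<in> space M. \<exists>t\<in>K. T t x = x} \<in> sets M"
proof -
  have "(\<lambda>x. (x, x)) \<in> M \<rightarrow>\<^sub>M M \<Otimes>\<^sub>M M" by simp
  from measurable_sets[OF this sets_orbit_graph_compact[OF assms]] show ?thesis
    by (rule back_subst[of "\<lambda>A. A \<in> sets M"]) (auto simp: space_pair_measure)
qed

text \<open>Pick return times converging to \<open>p\<close>. Along them \<open>h (T t x)\<close> is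
  constantly \<open>h x\<close>, so continuity and injectivity of \<open>h\<close> give the
  claim.\<close>

lemma return_time_limit:
  assumes "standard_borel M" and x: "x \<in> space M"
    and return: "\<And>n :: nat. \<exists>t\<in>{p - 1 / Suc n..p + 1 / Suc n}. T t x = x"
  shows "T p x = x"
proof -
  obtain h :: "'x \<Rightarrow> nat \<times> rat \<Rightarrow> real" where
    inj: "inj_on h (space M)" and cont: "continuous_on UNIV (\<lambda>t. h (T t x))"
    using orbit_continuous_embedding[OF assms(1)] x by metis
  obtain t where t: "\<And>n :: nat. t n \<in> {p - 1 / Suc n..p + 1 / Suc n}" "\<And>n. T (t n) x = x"
    using return by metis
  have "t \<longlonglongrightarrow> p"
  proof (rule tendsto_sandwich)
    have *: "(\<lambda>n. 1 / real (Suc n)) \<longlonglongrightarrow> 0" by (rule LIMSEQ_Suc[OF lim_1_over_n])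
    show "(\<lambda>n. p - 1 / Suc n) \<longlonglongrightarrow> p" "(\<lambda>n. p + 1 / Suc n) \<longlonglongrightarrow> p"
      using tendsto_diff[OF tendsto_const[of p] *] tendsto_add[OF tendsto_const[of p] *] by simp_all
  qed (use t(1) in auto)
  then have "(\<lambda>n. h (T (t n) x)) \<longlonglongrightarrow> h (T p x)"
    using cont by (auto intro: continuous_on_tendsto_compose)
  then have "h x = h (T p x)" by (simp add: t(2) LIMSEQ_const_iff)
  then show ?thesis using inj x T_in_space by (metis inj_onD)
qed

text \<open>The set of points returning at some time in a compact set is invariant, so it has measure
  0 or 1. If intervals shrinking to \<open>p\<close> all gave measure 1, almost every point would be fixed by
  \<open>T p\<close>.\<close>

lemma AE_no_return_within:
  assumes sb: "standard_borel M" and erg: "ergodic_flow M T" and ap: "aperiodic_flow M T"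
    and ab: "0 < a" "a \<le> b"
  shows "AE x in M. \<forall>t\<in>{a..b}. T t x \<noteq> x"
proof -
  define R where "R a b = {x \<in> space M. \<exists>t\<in>{a..b}. T t x = x}" for a b :: real
  have R [measurable]: "R a b \<in> sets M" for a b
    unfolding R_def by (rule sets_return_within[OF sb]) simp
  have "T s -` R a b \<inter> space M = R a b" for a b s
  proof -
    \<comment> \<open>The maps of the flow commute, so return times agree along an orbit; this makes
      \<open>R a b\<close> invariant.\<close>
    have "T t (T s x) = T s x \<longleftrightarrow> T t x = x" if x: "x \<in> space M" for x t
    proof -
      have "T t (T s x) = T s (T t x)"
        using flow_add[OF x, of t s] flow_add[OF x, of s t] by (simp add: add.commute)
      then show ?thesis using flow_inverse(1)[of _ s] x T_in_space by metis
    qed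
    then show ?thesis by (auto simp: R_def T_in_space)
  qed
  then have zero_one: "emeasure M (R a b) = 0 \<or> emeasure M (R a b) = 1" for a b
    using erg R by (auto simp: ergodic_flow_def)
  have "a > 0 \<longrightarrow> R a b \<in> null_sets M"
    using ab(2)
  \<comment> \<open>Bisection: nullness passes from two adjacent intervals to their union, so it is
    enough to find for each \<open>p\<close> a length below which every interval around
    \<open>p\<close> is null.\<close>
  proof (induction rule: Bolzano)
    case (trans a b c)
    have "R a c \<subseteq> R a b \<union> R b c" by (auto simp: R_def) (meson atLeastAtMost_iff linear)
    moreover have "a > 0 \<Longrightarrow> R a b \<union> R b c \<in> null_sets M"
      using trans by auto
    ultimately show ?case using null_sets_subset R by blast
  next
    case (local p)
    then have p: "p \<noteq> 0" using ab(1) by simp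
    obtain n :: nat where n: "R (p - 1 / Suc n) (p + 1 / Suc n) \<in> null_sets M"
    proof (rule ccontr)
      assume "\<not> thesis"
      then have "emeasure M (R (p - 1 / Suc n) (p + 1 / Suc n)) = 1" for n
        using that zero_one R by (metis null_setsI)
      then have "AE x in M. x \<in> R (p - 1 / Suc n) (p + 1 / Suc n)" for n
        using R by (intro prob_eq_1[THEN iffD1]) (auto simp: emeasure_eq_measure)
      then have "AE x in M. \<forall>n :: nat. x \<in> R (p - 1 / Suc n) (p + 1 / Suc n)"
        by (simp add: AE_all_countable)
      moreover have "AE x in M. x \<notin> {x \<in> space M. T p x = x}"
        using ap p by (intro AE_not_in) (auto simp: aperiodic_flow_def)
      ultimately have "AE x in M. False"
        using AE_space
      proof eventually_elim
        case (elim x)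
        then have "T p x = x" by (intro return_time_limit[OF sb]) (auto simp: R_def)
        with elim show False by simp
      qed
      then show False by simp
    qed
    show ?case
    proof (intro exI conjI allI impI)
      fix a b :: real assume "a \<le> p \<and> p \<le> b \<and> b - a < 1 / Suc n"
      then have "{a..b} \<subseteq> {p - 1 / Suc n..p + 1 / Suc n}" by auto
      then have "R a b \<subseteq> R (p - 1 / Suc n) (p + 1 / Suc n)" by (auto simp: R_def)
      then show "R a b \<in> null_sets M" using n R null_sets_subset by blast
    qed simp
  qed
  then have "R a b \<in> null_sets M" using ab by simp
  from AE_not_in[OF this] AE_space show ?thesis
    by eventually_elim (auto simp: R_def)
qed

text \<open>The intervals from \<open>1 / Suc n\<close> to \<open>Suc n\<close> exhaust the positive
  times, so countably many null sets suffice. Negative times follow because inverses of return times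
  are return times.\<close>

lemma AE_free:
  assumes sb: "standard_borel M" and erg: "ergodic_flow M T" and ap: "aperiodic_flow M T"
  shows "AE x in M. \<forall>t. T t x = x \<longrightarrow> t = 0"
proof -
  have "AE x in M. \<forall>n :: nat. \<forall>t\<in>{1 / Suc n..Suc n}. T t x \<noteq> x"
    unfolding AE_all_countable
  proof
    fix n :: nat
    have "1 / real (Suc n) \<le> Suc n" by (simp add: divide_le_eq)  (simp add: algebra_simps)
    then show "AE x in M. \<forall>t\<in>{1 / Suc n..Suc n}. T t x \<noteq> x"
      by (intro AE_no_return_within assms) simp_all
  qed
  then show ?thesis
    using AE_space
  proof eventually_elim
    case (elim x)
    have no_return: "T t x \<noteq> x" if "t > 0" for t
    proof -
      obtain m :: nat where m: "1 / Suc m < t" using nat_approx_posE[OF \<open>t > 0\<close>] by blast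
      obtain k :: nat where k: "t \<le> real k" using real_arch_simple by blast
      have "1 / Suc (max m k) \<le> 1 / Suc m" by (simp add: frac_le)
      then have "t \<in> {1 / Suc (max m k)..Suc (max m k)}" using m k by auto
      then show ?thesis using elim(1) by blast
    qed
    show ?case
    proof (intro allI impI)
      fix t assume t: "T t x = x"
      then have "T (- t) x = x" using flow_inverse(1)[OF elim(2), of t] by simp
      then show "t = 0" using t no_return[of t] no_return[of "- t"] by linarith
    qed
  qed
qed

text \<open>On a free set the complement of the relation \<open>\<exists>t\<in>B. T t x = y\<close> within the orbit relation is the
  relation for \<open>- B\<close>, so measurability passes from closed sets to Borel sets.\<close>

lemma sets_orbit_graph:
  assumes sb: "standard_borel M" and Y: "Y \<in> sets M"
    and free: "\<And>x t. x \<in> Y \<Longrightarrow> T t x = x \<Longrightarrow> t = 0"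
    and B: "B \<in> sets borel"
  shows "{p \<in> space (M \<Otimes>\<^sub>M M). fst p \<in> Y \<and> (\<exists>t\<in>B. T t (fst p) = snd p)} \<in> sets (M \<Otimes>\<^sub>M M)"
    (is "?G B \<in> _")
proof -
  have inj: "s = t" if "x \<in> Y" "T s x = T t x" for x s t
  proof -
    have x: "x \<in> space M" using that(1) Y sets.sets_into_space by blast
    have "T (- t + s) x = x"
      using flow_add[OF x, of "- t" s] that(2) flow_inverse(1)[OF x] by simp
    from free[OF that(1) this] show ?thesis by simp
  qed
  have Y': "{p \<in> space (M \<Otimes>\<^sub>M M). fst p \<in> Y} \<in> sets (M \<Otimes>\<^sub>M M)" using Y by measurable
  have closed: "?G C \<in> sets (M \<Otimes>\<^sub>M M)" if "closed C" for C
  proof -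
    have "?G C = {p \<in> space (M \<Otimes>\<^sub>M M). fst p \<in> Y} \<inter>
        (\<Union>n::nat. {p \<in> space (M \<Otimes>\<^sub>M M). \<exists>t\<in>C \<inter> {- n..n}. T t (fst p) = snd p})"
    proof (intro set_eqI iffI)
      fix p assume "p \<in> ?G C"
      then obtain t where t: "t \<in> C" "T t (fst p) = snd p" "p \<in> ?G C" by auto
      obtain n :: nat where "\<bar>t\<bar> \<le> n" using real_arch_simple by blast
      then have "t \<in> C \<inter> {- n..n}" using t by auto
      then show "p \<in> {p \<in> space (M \<Otimes>\<^sub>M M). fst p \<in> Y} \<inter>
        (\<Union>n::nat. {p \<in> space (M \<Otimes>\<^sub>M M). \<exists>t\<in>C \<inter> {- n..n}. T t (fst p) = snd p})" using t(2,3) by (intro IntI UN_I[of n]) auto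
    qed auto
    also have "\<dots> \<in> sets (M \<Otimes>\<^sub>M M)"
      using sets_orbit_graph_compact[OF sb closed_Int_compact[OF that compact_Icc]]
      by (intro sets.Int Y' sets.countable_UN) blast
    finally show ?thesis .
  qed
  from B have "B \<in> sigma_sets UNIV (Collect closed)" by (simp add: borel_eq_closed)
  then show ?thesis
  proof induction
    case (Compl C)
    have "?G (UNIV - C) = ?G UNIV - ?G C" by (auto dest: inj)
    with Compl closed[of UNIV] show ?case by simp
  next
    case (Union C)
    have "?G (\<Union>i. C i) = (\<Union>i. ?G (C i))" by auto
    also have "\<dots> \<in> sets (M \<Otimes>\<^sub>M M)" using Union by blast
    finally show ?case .
  qed (use closed in auto)
qed

section \<open>Recovering the mixing measure from the integral joining\<close>

lemma obtain_free_set: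
  assumes "standard_borel M" "ergodic_flow M T" "aperiodic_flow M T"
  obtains Y where "Y \<in> sets M" "emeasure M Y = 1" "\<And>x t. x \<in> Y \<Longrightarrow> T t x = x \<Longrightarrow> t = 0"
proof -
  obtain N where N: "N \<in> null_sets M" "{x \<in> space M. \<not> (\<forall>t. T t x = x \<longrightarrow> t = 0)} \<subseteq> N"
    using AE_free[OF assms] by (auto simp: eventually_ae_filter)
  show thesis
  proof
    show "space M - N \<in> sets M" using N(1) by auto
    show "emeasure M (space M - N) = 1"
      using N(1) by (simp add: emeasure_Diff_null_set emeasure_space_1)
  qed (use N(2) in auto)
qed

text \<open>For a free point \<open>x\<close>, the parameter \<open>t\<close> can be read off from the tuple of the points
  \<open>T (- t \<epsilon>) x\<close>, and the coordinate at the zero vertex is \<open>x\<close> itself.\<close>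

lemma integral_offdiag_inj:
  assumes flow: "standard_borel M" "ergodic_flow M T" "aperiodic_flow M T"
    and Q: "prob_space Q" "sets Q = sets (param_space d)"
    and Q': "prob_space Q'" "sets Q' = sets (param_space d)"
    and eq: "integral_joining d M Q (\<lambda>t. offdiag d M T (\<lambda>\<epsilon>\<in>pcube d. - t \<epsilon>)) =
             integral_joining d M Q' (\<lambda>t. offdiag d M T (\<lambda>\<epsilon>\<in>pcube d. - t \<epsilon>))"
  shows "Q = Q'"
proof -
  obtain Y where Y: "Y \<in> sets M" "emeasure M Y = 1"
    and free: "\<And>x t. x \<in> Y \<Longrightarrow> T t x = x \<Longrightarrow> t = 0"
    using obtain_free_set[OF flow] by blast
  have pcube: "pcube d \<subseteq> cube d" "finite (pcube d)" by (auto simp: pcube_def)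
  \<comment> \<open>A zero-one test for a box: \<open>C\<close> has full measure under the joining
    with parameter \<open>- t\<close> if \<open>t\<close> lies in the box, and measure 0 otherwise.
    Integrating over \<open>t\<close> then returns the measure of the box.\<close>
  have detect: "\<exists>C\<in>sets (cube_space d M). \<forall>t\<in>space (param_space d).
      emeasure (offdiag d M T (\<lambda>\<epsilon>\<in>pcube d. - t \<epsilon>)) C = indicator (Pi\<^sub>E (pcube d) K) t"
    if K: "\<And>\<epsilon>. \<epsilon> \<in> pcube d \<Longrightarrow> K \<epsilon> \<in> sets borel" for K
  proof -
    \<comment> \<open>The coordinates are \<open>T (- t \<epsilon>) x\<close>, so the times from
      \<open>x\<close> are sought in the negative of \<open>K \<epsilon>\<close>.\<close>
    define G where "G \<epsilon> = {p \<in> space (M \<Otimes>\<^sub>M M). fst p \<in> Y \<and> (\<exists>s\<in>uminus -` K \<epsilon>. T s (fst p) = snd p)}" for \<epsilon>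
    have G: "G \<epsilon> \<in> sets (M \<Otimes>\<^sub>M M)" if "\<epsilon> \<in> pcube d" for \<epsilon>
    proof -
      have "uminus -` K \<epsilon> \<inter> space borel \<in> sets borel"
        using K[OF that] by (intro measurable_sets[of uminus borel borel]) auto
      then show ?thesis
        unfolding G_def by (intro sets_orbit_graph flow(1) Y(1) free) auto
    qed
    let ?C = "space (cube_space d M) \<inter>
      (\<Inter>\<epsilon>\<in>pcube d. (\<lambda>z. (z (zero_vertex d), z \<epsilon>)) -` G \<epsilon> \<inter> space (cube_space d M))"
    have C: "?C \<in> sets (cube_space d M)"
    \<comment> \<open>For \<open>d = 0\<close> the punctured cube is empty and the intersection over
      it is the whole type.\<close>
    proof (cases "pcube d = {}")
      case False
      have "(\<lambda>z. (z (zero_vertex d), z \<epsilon>)) \<in> cube_space d M \<rightarrow>\<^sub>M M \<Otimes>\<^sub>M M" if "\<epsilon> \<in> pcube d" for \<epsilon>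
        using that pcube(1) by (intro measurable_Pair measurable_component_singleton) auto
      then show ?thesis
        using False pcube(2) G by (intro sets.Int sets.top sets.finite_INT measurable_sets) auto
    qed simp
    moreover have "emeasure (offdiag d M T (\<lambda>\<epsilon>\<in>pcube d. - t \<epsilon>)) ?C = indicator (Pi\<^sub>E (pcube d) K) t"
      if t: "t \<in> space (param_space d)" for t
    proof -
      let ?f = "\<lambda>x. \<lambda>\<epsilon>\<in>cube d. T (coord d (\<lambda>\<epsilon>\<in>pcube d. - t \<epsilon>) \<epsilon>) x"
      let ?V = "?f -` ?C \<inter> space M"
      have in_space: "?f x \<in> space (cube_space d M)" if "x \<in> space M" for x
        using measurable_space[OF measurable_offdiag_map that] .
      have f0: "?f x (zero_vertex d) = x" if "x \<in> space M" for x
        using that by (simp add: coord_def flow_0)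
      have f: "?f x \<epsilon> = T (- t \<epsilon>) x" if "\<epsilon> \<in> pcube d" for x \<epsilon>
        using that by (auto simp: coord_def pcube_def)
      have V: "x \<in> ?V \<longleftrightarrow> x \<in> space M \<and> (\<forall>\<epsilon>\<in>pcube d. x \<in> Y \<and> (\<exists>s\<in>uminus -` K \<epsilon>. T s x = T (- t \<epsilon>) x))" for x
        using in_space[of x] f0[of x] f[of _ x] T_in_space[of x]
        by (auto simp: G_def space_pair_measure)
      have em: "emeasure (offdiag d M T (\<lambda>\<epsilon>\<in>pcube d. - t \<epsilon>)) ?C = emeasure M ?V"
        unfolding offdiag_def using C by (intro emeasure_distr measurable_offdiag_map)
      show ?thesis
      proof (cases "t \<in> Pi\<^sub>E (pcube d) K")
        case True
        have "x \<in> ?V" if "x \<in> Y" for x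
        proof -
          have "\<exists>s\<in>uminus -` K \<epsilon>. T s x = T (- t \<epsilon>) x" if "\<epsilon> \<in> pcube d" for \<epsilon>
            using that True by (intro bexI[of _ "- t \<epsilon>"]) auto
          then show ?thesis
            unfolding V using that Y(1) sets.sets_into_space by blast
        qed
        then have "emeasure M Y \<le> emeasure M ?V"
          by (intro emeasure_mono subsetI measurable_sets[OF measurable_offdiag_map C])
        then have "emeasure M ?V = 1" using Y(2) emeasure_le_1[of ?V] by simp
        then show ?thesis using em True by simp
      next
        case False
        \<comment> \<open>As a point of the parameter space \<open>t\<close> is extensional, so it
          can miss the box only in some coordinate.\<close>
        then obtain \<epsilon> where \<epsilon>: "\<epsilon> \<in> pcube d" "t \<epsilon> \<notin> K \<epsilon>"
          using t by (auto simp: space_PiM PiE_iff)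
        have "x \<notin> ?V" for x
        proof
          assume "x \<in> ?V"
          then obtain s where s: "x \<in> space M" "x \<in> Y" "- s \<in> K \<epsilon>" "T s x = T (- t \<epsilon>) x"
            unfolding V using \<epsilon>(1) by auto
          have "T (t \<epsilon> + s) x = x"
            using flow_add[of x "t \<epsilon>" s] flow_inverse(2)[of x "t \<epsilon>"] s by simp
          from free[OF s(2) this] show False using \<epsilon>(2) s(3) by (simp add: add_eq_0_iff)
        qed
        then have "?V = {}" by blast
        then show ?thesis using em False by simp
      qed
    qed
    ultimately show ?thesis by blast
  qed
  have em: "emeasure (integral_joining d M P (\<lambda>t. offdiag d M T (\<lambda>\<epsilon>\<in>pcube d. - t \<epsilon>))) C =
      emeasure P (Pi\<^sub>E (pcube d) K)"
    if P: "sets P = sets (param_space d)" and K: "\<And>\<epsilon>. \<epsilon> \<in> pcube d \<Longrightarrow> K \<epsilon> \<in> sets borel"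
      and C: "C \<in> sets (cube_space d M)" "\<forall>t\<in>space (param_space d).
      emeasure (offdiag d M T (\<lambda>\<epsilon>\<in>pcube d. - t \<epsilon>)) C = indicator (Pi\<^sub>E (pcube d) K) t"
    for P C and K :: "_ \<Rightarrow> real set"
  proof -
    have "emeasure (integral_joining d M P (\<lambda>t. offdiag d M T (\<lambda>\<epsilon>\<in>pcube d. - t \<epsilon>))) C =
        (\<integral>\<^sup>+t. emeasure (offdiag d M T (\<lambda>\<epsilon>\<in>pcube d. - t \<epsilon>)) C \<partial>P)"
      by (intro emeasure_integral_joining sets_offdiag measurable_emeasure_offdiag P C(1))
    also have "\<dots> = (\<integral>\<^sup>+t. indicator (Pi\<^sub>E (pcube d) K) t \<partial>P)"
      using C(2) sets_eq_imp_space_eq[OF P] by (intro nn_integral_cong) simp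
    also have "\<dots> = emeasure P (Pi\<^sub>E (pcube d) K)"
      using K pcube(2) by (intro nn_integral_indicator) (simp add: P sets_PiM_I_finite)
    finally show ?thesis .
  qed
  show ?thesis
  proof (rule measure_eqI_PiM_finite[where A = "\<lambda>_. space (param_space d)"])
    show "range (\<lambda>_::nat. space (param_space d)) \<subseteq> prod_algebra (pcube d) (\<lambda>_. borel)"
      using pcube(2) by (auto simp: space_PiM intro!: prod_algebraI_finite)
    show "emeasure Q (space (param_space d)) \<noteq> \<infinity>" for i :: nat
      using prob_space.emeasure_space_1[OF Q(1)] sets_eq_imp_space_eq[OF Q(2)] by simp
    fix K :: "_ \<Rightarrow> real set" assume K: "\<And>\<epsilon>. \<epsilon> \<in> pcube d \<Longrightarrow> K \<epsilon> \<in> sets borel"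
    obtain C where C: "C \<in> sets (cube_space d M)" "\<forall>t\<in>space (param_space d).
      emeasure (offdiag d M T (\<lambda>\<epsilon>\<in>pcube d. - t \<epsilon>)) C = indicator (Pi\<^sub>E (pcube d) K) t"
      by (rule bexE[OF detect[of K]]) (use K in auto)
    have "emeasure Q (Pi\<^sub>E (pcube d) K) =
        emeasure (integral_joining d M Q (\<lambda>t. offdiag d M T (\<lambda>\<epsilon>\<in>pcube d. - t \<epsilon>))) C"
      by (rule em[OF Q(2) _ C, symmetric]) (rule K)
    also have "\<dots> = emeasure Q' (Pi\<^sub>E (pcube d) K)"
      unfolding eq by (rule em[OF Q'(2) _ C]) (rule K)
    finally show "emeasure Q (Pi\<^sub>E (pcube d) K) = emeasure Q' (Pi\<^sub>E (pcube d) K)" .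
  qed (use Q(2) Q'(2) pcube(2) in auto)
qed

end

subsection \<open>Reflection of off-diagonal joinings\<close>

lemma opposite_in_cube [simp]: "opposite d \<epsilon> \<in> cube d"
  by (auto simp: opposite_def cube_def)

lemma opposite_opposite: "\<epsilon> \<in> cube d \<Longrightarrow> opposite d (opposite d \<epsilon>) = \<epsilon>"
  by (rule extensionalityI[of _ "{..<d}"]) (force simp: opposite_def cube_def PiE_iff)+

lemma opposite_zero_vertex: "opposite d (zero_vertex d) = one_vertex d"
  by (auto simp: opposite_def zero_vertex_def one_vertex_def)

text \<open>The defining formula extends to the zero vertex: its opposite is
  \<open>one_vertex d\<close>, so both sides vanish there.\<close>

lemma coord_theta:
  "\<epsilon> \<in> cube d \<Longrightarrow> coord d (theta d t) \<epsilon> = coord d t (one_vertex d) - coord d t (opposite d \<epsilon>)"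
  by (cases "\<epsilon> = zero_vertex d") (simp_all add: coord_def opposite_zero_vertex theta_def pcube_def)

lemma coord_uminus:
  "\<epsilon> \<in> cube d \<Longrightarrow> coord d (\<lambda>\<epsilon>\<in>pcube d. - t \<epsilon>) \<epsilon> = - coord d t \<epsilon>"
  by (simp add: coord_def pcube_def)

lemma one_vertex_in_cube [simp]: "one_vertex d \<in> cube d"
  by (auto simp: one_vertex_def cube_def)

lemma theta_uminus: "theta d (\<lambda>\<epsilon>\<in>pcube d. - t \<epsilon>) = (\<lambda>\<epsilon>\<in>pcube d. - theta d t \<epsilon>)"
  by (auto simp: theta_def coord_uminus intro!: restrict_ext)

lemma vertex_sum_opposite:
  assumes "\<epsilon> \<in> cube d"
  shows "vertex_sum d x (one_vertex d) - vertex_sum d x (opposite d \<epsilon>) = vertex_sum d x \<epsilon>"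
  unfolding vertex_sum_def sum_subtractf[symmetric]
proof (rule sum.cong)
  fix i assume "i \<in> {..<d}"
  \<comment> \<open>Entries are 0 or 1, so the truncated subtraction in \<open>opposite\<close> is a
    true complement.\<close>
  then have "\<epsilon> i = 0 \<or> \<epsilon> i = 1" using assms by (auto simp: cube_def PiE_iff)
  then show "real (one_vertex d i) * x i - real (opposite d \<epsilon> i) * x i = real (\<epsilon> i) * x i"
    using \<open>i \<in> {..<d}\<close> by (auto simp: one_vertex_def opposite_def)
qed simp

text \<open>A vertex and its opposite add up to \<open>one_vertex d\<close>, and
  \<open>vertex_sum\<close> is linear in the vertex. It is 0 at the zero vertex, in agreement with
  the convention for \<open>coord\<close>.\<close>

lemma theta_vertex_sum:
  "theta d (\<lambda>\<epsilon>\<in>pcube d. vertex_sum d x \<epsilon>) = (\<lambda>\<epsilon>\<in>pcube d. vertex_sum d x \<epsilon>)"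
proof -
  have "coord d (\<lambda>\<epsilon>\<in>pcube d. vertex_sum d x \<epsilon>) \<epsilon> = vertex_sum d x \<epsilon>" if "\<epsilon> \<in> cube d" for \<epsilon>
    using that by (auto simp: coord_def pcube_def vertex_sum_def zero_vertex_def)
  then show ?thesis
    unfolding theta_def by (intro restrict_ext) (simp add: vertex_sum_opposite pcube_def)
qed

definition reflect ::
    "nat \<Rightarrow> ('x \<Rightarrow> 'x) \<Rightarrow> ((nat \<Rightarrow> nat) \<Rightarrow> 'x) \<Rightarrow> (nat \<Rightarrow> nat) \<Rightarrow> 'x" where
  "reflect d S z = (\<lambda>\<epsilon>\<in>cube d. S (z (opposite d \<epsilon>)))"

lemma measurable_reflect:
  assumes "S \<in> M \<rightarrow>\<^sub>M M"
  shows "reflect d S \<in> cube_space d M \<rightarrow>\<^sub>M cube_space d M"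
  unfolding reflect_def
  by (intro measurable_restrict measurable_compose[OF _ assms] measurable_component_singleton) simp

text \<open>Convergence of joinings is tested on product sets only, so preimages of product sets
  have to be product sets again.\<close>

lemma vimage_reflect_PiE:
  assumes "S \<in> M \<rightarrow>\<^sub>M M"
  shows "reflect d S -` Pi\<^sub>E (cube d) A \<inter> space (cube_space d M) =
    Pi\<^sub>E (cube d) (\<lambda>\<epsilon>. S -` A (opposite d \<epsilon>) \<inter> space M)" (is "?L = ?R")
proof (intro set_eqI iffI)
  fix z assume z: "z \<in> ?L"
  have "S (z \<epsilon>) \<in> A (opposite d \<epsilon>)" if "\<epsilon> \<in> cube d" for \<epsilon>
    using z PiE_mem[of "reflect d S z" "cube d" A "opposite d \<epsilon>"] that
    by (simp add: reflect_def opposite_opposite)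
  then show "z \<in> ?R" using z by (auto simp: space_PiM PiE_iff)
next
  fix z assume z: "z \<in> ?R"
  have "S (z (opposite d \<epsilon>)) \<in> A \<epsilon>" if "\<epsilon> \<in> cube d" for \<epsilon>
    using PiE_mem[OF z, of "opposite d \<epsilon>"] that by (simp add: opposite_opposite)
  then show "z \<in> ?L" using z by (auto simp: reflect_def space_PiM PiE_iff)
qed

context mp_flow
begin

text \<open>Moving \<open>S\<close> inside the flow reverses time, which gives the coordinates
  \<open>T (- coord d t (opposite d \<epsilon>)) (S x)\<close>. Since \<open>S\<close> and the flow
  preserve the measure, \<open>S x\<close> may be replaced by \<open>x\<close> and then by
  \<open>T (coord d t (one_vertex d)) x\<close>; the last shift returns the zero vertex to time
  0.\<close>

lemma distr_offdiag_reflect: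
  assumes S [measurable]: "S \<in> M \<rightarrow>\<^sub>M M" and pres: "distr M M S = M"
    and inv: "\<And>t. AE x in M. T t (S x) = S (T (- t) x)"
  shows "distr (offdiag d M T t) (cube_space d M) (reflect d S) = offdiag d M T (theta d t)"
proof -
  let ?f = "\<lambda>x. \<lambda>\<epsilon>\<in>cube d. T (- coord d t (opposite d \<epsilon>)) x"
  have f [measurable]: "?f \<in> M \<rightarrow>\<^sub>M cube_space d M" by (intro measurable_restrict) auto
  have "distr (offdiag d M T t) (cube_space d M) (reflect d S) =
      distr M (cube_space d M) (reflect d S \<circ> (\<lambda>x. \<lambda>\<epsilon>\<in>cube d. T (coord d t \<epsilon>) x))"
    unfolding offdiag_def by (rule distr_distr[OF measurable_reflect[OF S] measurable_offdiag_map])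
  also have "\<dots> = distr M (cube_space d M) (?f \<circ> S)"
  proof (rule distr_cong_AE)
    \<comment> \<open>The exceptional null set depends on the time, but only one time for each of
      the finitely many vertices occurs.\<close>
    have "AE x in M. \<forall>\<epsilon>\<in>cube d. T (- coord d t (opposite d \<epsilon>)) (S x) = S (T (coord d t (opposite d \<epsilon>)) x)"
    proof (rule AE_finite_allI)
      show "AE x in M. T (- coord d t (opposite d \<epsilon>)) (S x) = S (T (coord d t (opposite d \<epsilon>)) x)" for \<epsilon>
        using inv[of "- coord d t (opposite d \<epsilon>)"] by simp
    qed simp
    then show "AE x in M. (reflect d S \<circ> (\<lambda>x. \<lambda>\<epsilon>\<in>cube d. T (coord d t \<epsilon>) x)) x = (?f \<circ> S) x"
      by eventually_elim (auto simp: reflect_def intro!: restrict_ext)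
  qed (use measurable_comp[OF measurable_offdiag_map measurable_reflect[OF S]] measurable_comp[OF S f] in auto)
  also have "\<dots> = distr (distr M M S) (cube_space d M) ?f"
    by (rule distr_distr[OF f S, symmetric])
  also have "\<dots> = distr (distr M M (T (coord d t (one_vertex d)))) (cube_space d M) ?f"
    by (simp add: pres flow_preserving)
  also have "\<dots> = distr M (cube_space d M) (?f \<circ> T (coord d t (one_vertex d)))"
    by (rule distr_distr[OF f measurable_T])
  also have "\<dots> = offdiag d M T (theta d t)"
    unfolding offdiag_def
  proof (rule distr_cong[OF refl refl])
    fix x assume x: "x \<in> space M"
    have "T (- coord d t (opposite d \<epsilon>)) (T (coord d t (one_vertex d)) x) = T (coord d (theta d t) \<epsilon>) x"
      if "\<epsilon> \<in> cube d" for \<epsilon>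
      using flow_add[OF x, of "- coord d t (opposite d \<epsilon>)" "coord d t (one_vertex d)"] that
      by (simp add: coord_theta)
    then show "(?f \<circ> T (coord d t (one_vertex d))) x = (\<lambda>\<epsilon>\<in>cube d. T (coord d (theta d t) \<epsilon>) x)"
      by (auto intro!: restrict_ext)
  qed
  finally show ?thesis .
qed

text \<open>Each product set and its preimage both have convergent measures, so limits can be
  compared; product sets determine the measure.\<close>

lemma joinings_tendsto_distr_reflect:
  assumes S: "S \<in> M \<rightarrow>\<^sub>M M"
    and lim: "joinings_tendsto d M T \<nu> \<rho>"
    and fixed: "\<And>n. distr (\<nu> n) (cube_space d M) (reflect d S) = \<nu> n"
  shows "distr \<rho> (cube_space d M) (reflect d S) = \<rho>"
proof -
  have joining: "prob_space \<sigma> \<and> sets \<sigma> = sets (cube_space d M)" if "\<sigma> \<in> joinings d M T" for \<sigma>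
    using that by (simp add: joinings_def)
  have \<nu>: "\<And>n. prob_space (\<nu> n)" "\<And>n. sets (\<nu> n) = sets (cube_space d M)"
    and \<rho>: "prob_space \<rho>" "sets \<rho> = sets (cube_space d M)"
    using lim joining by (auto simp: joinings_tendsto_def)
  have meas: "reflect d S \<in> \<sigma> \<rightarrow>\<^sub>M cube_space d M" if "sets \<sigma> = sets (cube_space d M)" for \<sigma>
    using measurable_reflect[OF S] measurable_cong_sets[OF that refl] by blast
  interpret \<rho>: prob_space \<rho> by (rule \<rho>(1))
  interpret \<rho>': prob_space "distr \<rho> (cube_space d M) (reflect d S)"
    by (rule \<rho>.prob_space_distr) (rule meas[OF \<rho>(2)])
  show ?thesis
  proof (rule measure_eqI_PiM_finite[where A = "\<lambda>_. space (cube_space d M)"])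
    show "range (\<lambda>_::nat. space (cube_space d M)) \<subseteq> prod_algebra (cube d) (\<lambda>_. M)"
      by (auto simp: space_PiM intro!: prod_algebraI_finite)
    fix A assume A: "\<And>\<epsilon>. \<epsilon> \<in> cube d \<Longrightarrow> A \<epsilon> \<in> sets M"
    have PA: "Pi\<^sub>E (cube d) A \<in> sets (cube_space d M)"
      using A by (intro sets_PiM_I_finite) auto
    have dist: "measure (distr \<sigma> (cube_space d M) (reflect d S)) (Pi\<^sub>E (cube d) A) =
        measure \<sigma> (Pi\<^sub>E (cube d) (\<lambda>\<epsilon>. S -` A (opposite d \<epsilon>) \<inter> space M))"
      if "sets \<sigma> = sets (cube_space d M)" for \<sigma>
      using measure_distr[OF meas[OF that] PA]
      by (simp add: sets_eq_imp_space_eq[OF that] vimage_reflect_PiE[OF S])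
    have "(\<lambda>n. measure (\<nu> n) (Pi\<^sub>E (cube d) A)) \<longlonglongrightarrow> measure \<rho> (Pi\<^sub>E (cube d) A)"
      using lim A by (simp add: joinings_tendsto_def)
    moreover have "(\<lambda>n. measure (\<nu> n) (Pi\<^sub>E (cube d) (\<lambda>\<epsilon>. S -` A (opposite d \<epsilon>) \<inter> space M))) \<longlonglongrightarrow>
        measure \<rho> (Pi\<^sub>E (cube d) (\<lambda>\<epsilon>. S -` A (opposite d \<epsilon>) \<inter> space M))"
      using lim A S by (simp add: joinings_tendsto_def measurable_sets)
    then have "(\<lambda>n. measure (\<nu> n) (Pi\<^sub>E (cube d) A)) \<longlonglongrightarrow>
        measure (distr \<rho> (cube_space d M) (reflect d S)) (Pi\<^sub>E (cube d) A)"
      using fixed dist[OF \<nu>(2)] dist[OF \<rho>(2)] by simp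
    ultimately have "measure (distr \<rho> (cube_space d M) (reflect d S)) (Pi\<^sub>E (cube d) A) =
        measure \<rho> (Pi\<^sub>E (cube d) A)"
      by (rule LIMSEQ_unique[symmetric])
    then show "emeasure (distr \<rho> (cube_space d M) (reflect d S)) (Pi\<^sub>E (cube d) A) =
        emeasure \<rho> (Pi\<^sub>E (cube d) A)"
      by (simp add: \<rho>.emeasure_eq_measure \<rho>'.emeasure_eq_measure)
  qed (use \<rho>(2) \<rho>'.emeasure_finite in auto)
qed

text \<open>Reflection acts on each parameter by \<open>theta\<close>, which commutes with the sign
  change by linearity; a change of variables moves it to the mixing measure.\<close>

lemma distr_integral_offdiag_reflect:
  assumes S: "S \<in> M \<rightarrow>\<^sub>M M" and pres: "distr M M S = M"
    and inv: "\<And>t. AE x in M. T t (S x) = S (T (- t) x)"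
    and Q: "sets Q = sets (param_space d)"
  shows "distr (integral_joining d M Q (\<lambda>t. offdiag d M T (\<lambda>\<epsilon>\<in>pcube d. - t \<epsilon>)))
      (cube_space d M) (reflect d S) =
    integral_joining d M (distr Q (param_space d) (theta d)) (\<lambda>t. offdiag d M T (\<lambda>\<epsilon>\<in>pcube d. - t \<epsilon>))"
    (is "distr (?J Q) _ _ = ?J ?Q'")
proof (rule measure_eqI)
  fix C assume "C \<in> sets (distr (?J Q) (cube_space d M) (reflect d S))"
  then have C: "C \<in> sets (cube_space d M)" by simp
  have J: "sets (?J Q) = sets (cube_space d M)" by (simp add: integral_joining_def)
  have meas: "reflect d S \<in> \<sigma> \<rightarrow>\<^sub>M cube_space d M" if "sets \<sigma> = sets (cube_space d M)" for \<sigma>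
    using measurable_reflect[OF S] measurable_cong_sets[OF that refl] by blast
  let ?D = "reflect d S -` C \<inter> space (cube_space d M)"
  have D: "?D \<in> sets (cube_space d M)" by (rule measurable_sets[OF measurable_reflect[OF S] C])
  have em: "emeasure (?J P) B = (\<integral>\<^sup>+t. emeasure (offdiag d M T (\<lambda>\<epsilon>\<in>pcube d. - t \<epsilon>)) B \<partial>P)"
    if "sets P = sets (param_space d)" "B \<in> sets (cube_space d M)" for P B
    by (intro emeasure_integral_joining sets_offdiag measurable_emeasure_offdiag that)
  have "emeasure (distr (?J Q) (cube_space d M) (reflect d S)) C = emeasure (?J Q) ?D"
    using emeasure_distr[OF meas[OF J] C] sets_eq_imp_space_eq[OF J] by simp
  also have "\<dots> = (\<integral>\<^sup>+t. emeasure (offdiag d M T (\<lambda>\<epsilon>\<in>pcube d. - t \<epsilon>)) ?D \<partial>Q)"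
    by (rule em[OF Q D])
  also have "\<dots> = (\<integral>\<^sup>+t. emeasure (offdiag d M T (\<lambda>\<epsilon>\<in>pcube d. - theta d t \<epsilon>)) C \<partial>Q)"
  proof (rule nn_integral_cong)
    fix t :: "(nat \<Rightarrow> nat) \<Rightarrow> real"
    let ?t = "\<lambda>\<epsilon>\<in>pcube d. - t \<epsilon>"
    have "emeasure (offdiag d M T ?t) ?D = emeasure (distr (offdiag d M T ?t) (cube_space d M) (reflect d S)) C"
      using emeasure_distr[OF meas[OF sets_offdiag] C] sets_eq_imp_space_eq[OF sets_offdiag] by metis
    then show "emeasure (offdiag d M T ?t) ?D = emeasure (offdiag d M T (\<lambda>\<epsilon>\<in>pcube d. - theta d t \<epsilon>)) C"
      by (simp only: distr_offdiag_reflect[OF S pres inv] theta_uminus)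
  qed
  also have "\<dots> = (\<integral>\<^sup>+t. emeasure (offdiag d M T (\<lambda>\<epsilon>\<in>pcube d. - t \<epsilon>)) C \<partial>?Q')"
    using measurable_theta[of d] measurable_cong_sets[OF Q refl]
    by (subst nn_integral_distr) (auto intro: measurable_emeasure_offdiag[OF _ C])
  also have "\<dots> = emeasure (?J ?Q') C"
    by (rule em[OF _ C, symmetric]) simp
  finally show "emeasure (distr (?J Q) (cube_space d M) (reflect d S)) C = emeasure (?J ?Q') C" .
qed (simp add: integral_joining_def)

end

theorem proposition3p9:
  fixes M :: "'x measure" and T :: "real \<Rightarrow> 'x \<Rightarrow> 'x" and d :: nat
    and q :: "nat \<Rightarrow> nat \<Rightarrow> real" and Q :: "((nat \<Rightarrow> nat) \<Rightarrow> real) measure"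
  assumes "standard_borel M"
    and "mp_flow M T"
    and "ergodic_flow M T"
    and "aperiodic_flow M T"
    and "d \<ge> 1"
    and "prob_space Q" and "sets Q = sets (param_space d)"
    and "joinings_tendsto d M T
           (\<lambda>n. offdiag d M T (\<lambda>\<epsilon>\<in>pcube d. vertex_sum d (q n) \<epsilon>))
           (integral_joining d M Q (\<lambda>t. offdiag d M T (\<lambda>\<epsilon>\<in>pcube d. - t \<epsilon>)))"
    and "distr Q (param_space d) (theta d) \<noteq> Q"
  shows "\<not> isomorphic_to_inverse M T \<and> \<not> reversible M T"
proof -
  interpret mp_flow M T by fact
  interpret Q: prob_space Q by fact
  \<comment> \<open>Reversibility also requires an inverting map, so excluding these settles both
    claims.\<close>
  have "\<not> inverting_map M T S" for S
  proof
    assume "inverting_map M T S"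
    then have S: "S \<in> M \<rightarrow>\<^sub>M M" "distr M M S = M" and inv: "\<And>t. AE x in M. T t (S x) = S (T (- t) x)"
      by (auto simp: inverting_map_def invertible_mp_def)
    let ?Q' = "distr Q (param_space d) (theta d)"
    have "theta d \<in> Q \<rightarrow>\<^sub>M param_space d"
      using measurable_theta[of d] measurable_cong_sets[OF assms(7) refl] by blast
    then have Q': "prob_space ?Q'" by (rule Q.prob_space_distr)
    \<comment> \<open>All approximating joinings are fixed by the reflection, hence so is their
      limit.\<close>
    have "integral_joining d M ?Q' (\<lambda>t. offdiag d M T (\<lambda>\<epsilon>\<in>pcube d. - t \<epsilon>)) =
        integral_joining d M Q (\<lambda>t. offdiag d M T (\<lambda>\<epsilon>\<in>pcube d. - t \<epsilon>))"
      unfolding distr_integral_offdiag_reflect[OF S inv assms(7), symmetric]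
      by (rule joinings_tendsto_distr_reflect[OF S(1) assms(8)])
        (simp only: distr_offdiag_reflect[OF S inv] theta_vertex_sum)
    then have "?Q' = Q"
      using assms Q' by (intro integral_offdiag_inj) simp_all
    with assms(9) show False by simp
  qed
  then show ?thesis
    by (simp add: isomorphic_to_inverse_def reversible_def)
qed

end
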